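(* Let $r\ge 1$ and $n\ge 1$ be integers and let $G$ be the $r$-King graph of size $n$. Then $\alpha_{\mathrm{od}}(G)=\left\lceil \frac{n}{2r+1}\right\rceil^2$. Moreover, $\chi_{\mathrm{so}}(G)=(2r+1)^2$ if $n\ge 2r+1$, and $\chi_{\mathrm{so}}(G)=n^2$ if $n\le 2r$.
   Context: The $r$-King graph of size $n$ has vertex set $\{1,\dots,n\}\times\{1,\dots,n\}$, and two distinct vertices $(a,b),(a',b')$ are adjacent iff $|a-a'|\le r$ and $|b-b'|\le r$. $N(v)$ is the open neighborhood of $v$. An odd independent set is an independent set $S$ of vertices such that every vertex $v\notin S$ has either $N(v)\cap S=\varnothing$ or $|N(v)\cap S|$ odd; $\alpha_{\mathrm{od}}(G)$ is the largest cardinality of an odd independent set. A strong odd coloring is a proper vertex coloring such that for every vertex $v$, each color used in $N(v)$ appears an odd number of times in $N(v)$; $\chi_{\mathrm{so}}(G)$ is the minimum number of colors in a strong odd coloring. *)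

theory Defs
  imports Complex_Main "Graph_Theory.Pair_Digraph"
begin

text \<open>
  A finite simple graph is a \<^locale>\<open>pair_graph\<close>: an edge between \<open>u\<close> and \<open>v\<close> is the
  symmetric pair of arcs \<open>(u, v)\<close>, \<open>(v, u)\<close>. Since \<^const>\<open>Max\<close> and \<open>LEAST\<close> are total,
  lemmas below record that the two graph parameters are attained on such graphs.
\<close>

definition king_graph :: "nat \<Rightarrow> nat \<Rightarrow> (nat \<times> nat) pair_pre_digraph" where
  "king_graph r n =
    \<lparr> pverts = {1..n} \<times> {1..n},
      parcs = {((a, b), (a', b')) | a b a' b'.
        a \<in> {1..n} \<and> b \<in> {1..n} \<and> a' \<in> {1..n} \<and> b' \<in> {1..n} \<and> (a, b) \<noteq> (a', b') \<and>
        \<bar>int a - int a'\<bar> \<le> int r \<and> \<bar>int b - int b'\<bar> \<le> int r} \<rparr>"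

definition neighborhood :: "'a pair_pre_digraph \<Rightarrow> 'a \<Rightarrow> 'a set" where
  "neighborhood G v = {u \<in> pverts G. (v, u) \<in> parcs G}"

definition independent_set :: "'a pair_pre_digraph \<Rightarrow> 'a set \<Rightarrow> bool" where
  "independent_set G S \<longleftrightarrow> S \<subseteq> pverts G \<and> (\<forall>u\<in>S. \<forall>v\<in>S. (u, v) \<notin> parcs G)"

definition odd_independent_set :: "'a pair_pre_digraph \<Rightarrow> 'a set \<Rightarrow> bool" where
  "odd_independent_set G S \<longleftrightarrow> independent_set G S \<and>
    (\<forall>v \<in> pverts G - S. neighborhood G v \<inter> S = {} \<or> odd (card (neighborhood G v \<inter> S)))"

definition odd_independence_number :: "'a pair_pre_digraph \<Rightarrow> nat" where
  "odd_independence_number G = Max (card ` {S. odd_independent_set G S})"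

definition proper_coloring :: "'a pair_pre_digraph \<Rightarrow> ('a \<Rightarrow> nat) \<Rightarrow> bool" where
  "proper_coloring G c \<longleftrightarrow> (\<forall>(u, v) \<in> parcs G. c u \<noteq> c v)"

definition strong_odd_coloring :: "'a pair_pre_digraph \<Rightarrow> ('a \<Rightarrow> nat) \<Rightarrow> bool" where
  "strong_odd_coloring G c \<longleftrightarrow> proper_coloring G c \<and>
    (\<forall>v \<in> pverts G. \<forall>k \<in> c ` neighborhood G v. odd (card {u \<in> neighborhood G v. c u = k}))"

definition strong_odd_chromatic_number :: "'a pair_pre_digraph \<Rightarrow> nat" where
  "strong_odd_chromatic_number G =
    (LEAST k. \<exists>c. strong_odd_coloring G c \<and> card (c ` pverts G) = k)"

lemma pair_graph_king_graph: "pair_graph (king_graph r n)"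
proof
  let ?V = "{1..n} \<times> {1..n}"
  show "finite (pverts (king_graph r n))"
    by (simp add: king_graph_def)
  have "parcs (king_graph r n) \<subseteq> ?V \<times> ?V"
    by (auto simp: king_graph_def)
  then show "finite (parcs (king_graph r n))"
    by (rule finite_subset) simp
  show "symmetric (with_proj (king_graph r n))"
    unfolding symmetric_def by (intro symI) (auto simp: king_graph_def)
qed (auto simp: king_graph_def)

lemma odd_independence_number_attained:
  assumes "pair_graph G"
  shows "\<exists>S. odd_independent_set G S \<and> card S = odd_independence_number G"
    and "odd_independent_set G S \<Longrightarrow> card S \<le> odd_independence_number G"
proof -
  interpret pair_graph G by fact
  have "{S. odd_independent_set G S} \<subseteq> Pow (pverts G)"
    by (auto simp: odd_independent_set_def independent_set_def)
  moreover have "finite (Pow (pverts G))"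
    by (simp add: pair_finite_verts)
  ultimately have "finite {S. odd_independent_set G S}"
    by (rule finite_subset)
  then have fin: "finite (card ` {S. odd_independent_set G S})"
    by (rule finite_imageI)
  have "odd_independent_set G {}"
    by (simp add: odd_independent_set_def independent_set_def)
  then have "card ` {S. odd_independent_set G S} \<noteq> {}"
    by blast
  from Max_in[OF fin this]
  show "\<exists>S. odd_independent_set G S \<and> card S = odd_independence_number G"
    by (auto simp: odd_independence_number_def)
  show "odd_independent_set G S \<Longrightarrow> card S \<le> odd_independence_number G"
    using fin by (auto simp: odd_independence_number_def intro: Max_ge)
qed

lemma strong_odd_chromatic_number_attained:
  assumes "pair_graph G"
  shows "\<exists>c. strong_odd_coloring G c \<and> card (c ` pverts G) = strong_odd_chromatic_number G"
    and "strong_odd_coloring G c \<Longrightarrow> strong_odd_chromatic_number G \<le> card (c ` pverts G)"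
proof -
  interpret pair_graph G by fact
  obtain c :: "'a \<Rightarrow> nat" where inj: "inj_on c (pverts G)"
    using finite_imp_inj_to_nat_seg[OF pair_finite_verts] by blast
  have "{u \<in> neighborhood G v. c u = c w} = {w}" if "w \<in> neighborhood G v" for v w
    using that inj by (auto simp: neighborhood_def inj_on_def)
  moreover have "c u \<noteq> c v" if "(u, v) \<in> parcs G" for u v
    using that inj arc_fst_in_verts[OF that] arc_snd_in_verts[OF that] pair_no_loops[OF that]
    by (auto simp: inj_on_def)
  ultimately have "strong_odd_coloring G c"
    by (auto simp: strong_odd_coloring_def proper_coloring_def)
  then have "\<exists>k c. strong_odd_coloring G c \<and> card (c ` pverts G) = k"
    by blast
  then show "\<exists>c. strong_odd_coloring G c \<and> card (c ` pverts G) = strong_odd_chromatic_number G"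
    unfolding strong_odd_chromatic_number_def by (rule LeastI_ex)
  show "strong_odd_coloring G c \<Longrightarrow> strong_odd_chromatic_number G \<le> card (c ` pverts G)"
    for c
    unfolding strong_odd_chromatic_number_def by (rule Least_le) blast
qed

end

theory Submission
  imports Defs
begin

text \<open>
  Write \<open>m = 2r + 1\<close> and call two vertices \<open>d\<close>-near if both their coordinates differ by at most
  \<open>d\<close>. Everything follows from one characterization
  (\<open>odd_independent_king_iff\<close>): a set of vertices of the \<open>r\<close>-King graph is odd independent
  iff no two distinct members of it are \<open>2r\<close>-near.

  If no two members of \<open>S\<close> are \<open>2r\<close>-near, then every neighborhood contains at most one
  member, so \<open>S\<close> is odd independent. The converse is an extremal argument
  (\<open>odd_independent_imp_far\<close>). Its engine is that a vertex \<open>r\<close>-near to two members of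
  \<open>S\<close> has at least two, hence at least three, neighbors in \<open>S\<close>. Among the members having another
  member \<open>2r\<close>-near, let \<open>p\<close> be highest, and let \<open>q\<close> be highest among the members
  \<open>2r\<close>-near to \<open>p\<close>. A vertex \<open>r\<close>-near to both and as high as possible sees a third member
  \<open>z\<close>, and maximality of \<open>q\<close> puts \<open>z\<close> at most as high as \<open>q\<close>. If \<open>p\<close> is at most \<open>r\<close>
  above \<open>q\<close>, the three points have pairwise vertical distance at most \<open>r\<close>, so independence
  forces horizontal distances above \<open>r\<close>, too much for a window of width \<open>2r + 1\<close>. Otherwise
  \<open>q\<close> and \<open>z\<close> lie in the same row, at distance between \<open>r + 1\<close> and \<open>2r\<close>; sliding the window
  horizontally just far enough to lose one of them, while keeping the other and \<open>p\<close>, leaves no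
  room for the third member that parity requires.

  Consequently an odd independent set has at most one member in each cell when the grid is cut
  into \<open>\<lceil>n / m\<rceil>\<^sup>2\<close> cells of side at most \<open>m\<close>, and the lower left corners of the cells attain this
  bound. A coloring is strong odd iff all its color classes are odd independent
  (\<open>strong_odd_coloring_iff_classes\<close>), that is, iff distinct \<open>2r\<close>-near vertices get
  different colors. Such a coloring is injective on a square of side \<open>min n m\<close>, and both the
  injective coloring and the coloring by residues modulo \<open>m\<close> are of this kind.
\<close>

section \<open>Nearness in the grid\<close>

text \<open>Chebyshev distance at most \<open>d\<close>, stated without subtraction.\<close>

definition near :: "nat \<Rightarrow> nat \<times> nat \<Rightarrow> nat \<times> nat \<Rightarrow> bool" where
  "near d p q \<longleftrightarrow> fst p \<le> fst q + d \<and> fst q \<le> fst p + d \<and>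
    snd p \<le> snd q + d \<and> snd q \<le> snd p + d"

lemma near_refl [simp]: "near d p p"
  by (simp add: near_def)

lemma near_sym: "near d p q \<longleftrightarrow> near d q p"
  by (auto simp: near_def)

lemma near_trans: "near d p v \<Longrightarrow> near d v q \<Longrightarrow> near (2 * d) p q"
  by (auto simp: near_def)

lemma pverts_king: "pverts (king_graph r n) = {1..n} \<times> {1..n}"
  by (simp add: king_graph_def)

lemma parcs_king_iff:
  "(p, q) \<in> parcs (king_graph r n) \<longleftrightarrow>
    p \<in> {1..n} \<times> {1..n} \<and> q \<in> {1..n} \<times> {1..n} \<and> p \<noteq> q \<and> near r p q"
  by (cases p; cases q) (auto simp: king_graph_def near_def)

lemma neighborhood_king:
  assumes "v \<in> {1..n} \<times> {1..n}"
  shows "neighborhood (king_graph r n) v = {u \<in> {1..n} \<times> {1..n}. u \<noteq> v \<and> near r v u}"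
  using assms unfolding neighborhood_def pverts_king parcs_king_iff by blast

section \<open>Odd independent sets of King graphs\<close>

text \<open>The only use of the parity condition in the extremal argument.\<close>

lemma odd_independent_third_point:
  assumes S: "odd_independent_set (king_graph r n) S"
    and pq: "p \<in> S" "q \<in> S" "p \<noteq> q"
    and v: "v \<in> {1..n} \<times> {1..n}" "near r v p" "near r v q"
  obtains z where "z \<in> S" "z \<noteq> p" "z \<noteq> q" "near r v z"
proof -
  let ?A = "neighborhood (king_graph r n) v \<inter> S"
  have sub: "S \<subseteq> {1..n} \<times> {1..n}"
    and ind: "\<And>x y. x \<in> S \<Longrightarrow> y \<in> S \<Longrightarrow> near r x y \<Longrightarrow> x = y"
    using S unfolding odd_independent_set_def independent_set_def pverts_king parcs_king_iff
    by blast+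
  have "v \<notin> S"
    using ind pq v by metis
  have mem: "x \<in> ?A \<longleftrightarrow> x \<in> S \<and> near r v x" for x
    using sub \<open>v \<notin> S\<close> v(1) by (auto simp: neighborhood_king)
  have "odd (card ?A)"
    using S v pq mem \<open>v \<notin> S\<close> unfolding odd_independent_set_def pverts_king by blast
  moreover have "card {p, q} = 2"
    using pq by simp
  ultimately have "?A \<noteq> {p, q}"
    by auto
  moreover have "{p, q} \<subseteq> ?A"
    using mem[of p] mem[of q] pq v by blast
  ultimately obtain z where "z \<in> ?A" "z \<notin> {p, q}"
    by blast
  then show thesis
    using mem[of z] that by blast
qed

lemma odd_independent_imp_far:
  assumes S: "odd_independent_set (king_graph r n) S"
    and "p0 \<in> S" "q0 \<in> S" "near (2 * r) p0 q0"
  shows "p0 = q0"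
proof (rule ccontr)
  assume "p0 \<noteq> q0"
  have sub: "S \<subseteq> {1..n} \<times> {1..n}"
    and ind: "\<And>x y. x \<in> S \<Longrightarrow> y \<in> S \<Longrightarrow> near r x y \<Longrightarrow> x = y"
    using S unfolding odd_independent_set_def independent_set_def pverts_king parcs_king_iff
    by blast+
  have bound: "1 \<le> fst x \<and> fst x \<le> n \<and> 1 \<le> snd x \<and> snd x \<le> n" if "x \<in> S" for x
    using sub that by (cases x) auto
  let ?T = "\<lambda>p. p \<in> S \<and> (\<exists>q\<in>S. q \<noteq> p \<and> near (2 * r) p q)"
  have "?T p0"
    using assms \<open>p0 \<noteq> q0\<close> by auto
  moreover have "\<forall>p. ?T p \<longrightarrow> snd p < n + 1"
    using bound by fastforce
  ultimately obtain p where p: "?T p" and pmax: "\<And>x. ?T x \<Longrightarrow> snd x \<le> snd p"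
    using ex_has_greatest_nat[of ?T p0 snd "n + 1"] by blast
  let ?Q = "\<lambda>q. q \<in> S \<and> q \<noteq> p \<and> near (2 * r) p q"
  obtain q1 where "?Q q1"
    using p by blast
  moreover have "\<forall>q. ?Q q \<longrightarrow> snd q < n + 1"
    using bound by fastforce
  ultimately obtain q where q: "?Q q" and qmax: "\<And>x. ?Q x \<Longrightarrow> snd x \<le> snd q"
    using ex_has_greatest_nat[of ?Q q1 snd "n + 1"] by blast
  have pS: "p \<in> S"
    using p by blast
  have "?T q"
    using p q near_sym by metis
  then have qp: "snd q \<le> snd p"
    by (rule pmax)
  obtain px py where pxy: "p = (px, py)" by (cases p)
  obtain qx qy where qxy: "q = (qx, qy)" by (cases q)
  have pb: "1 \<le> px" "px \<le> n" "1 \<le> py" "py \<le> n"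
    using bound[OF pS] pxy by auto
  have qb: "1 \<le> qx" "qx \<le> n" "1 \<le> qy" "qy \<le> n"
    using bound q qxy by auto
  have pq: "qx \<le> px + 2 * r" "px \<le> qx + 2 * r" "py \<le> qy + 2 * r" "qy \<le> py"
    using q qp by (auto simp: pxy qxy near_def)
  \<comment> \<open>By maximality of \<open>q\<close>, a third member seen together with \<open>p\<close> is never above \<open>q\<close>.\<close>
  have third: "\<exists>zx zy. (zx, zy) \<in> S \<and> (zx, zy) \<noteq> p \<and> (zx, zy) \<noteq> w \<and>
      near r v (zx, zy) \<and> zy \<le> qy"
    if w: "w \<in> S" "w \<noteq> p" and v: "v \<in> {1..n} \<times> {1..n}" "near r v p" "near r v w" for v w
  proof -
    obtain z where z: "z \<in> S" "z \<noteq> p" "z \<noteq> w" "near r v z"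
      using odd_independent_third_point[OF S pS w(1) w(2)[symmetric] v] by blast
    have "near (2 * r) p z"
      using near_trans near_sym v(2) z(4) by blast
    then have "snd z \<le> qy"
      using qmax[of z] z qxy by simp
    then show ?thesis
      using z by (metis prod.collapse)
  qed
  define vx where "vx = (px + qx) div 2"
  define vy where "vy = min (qy + r) n"
  have v: "(vx, vy) \<in> {1..n} \<times> {1..n}" "near r (vx, vy) p" "near r (vx, vy) q"
    using pb qb pq unfolding pxy qxy vx_def vy_def near_def by auto
  obtain zx zy where z: "(zx, zy) \<in> S" "(zx, zy) \<noteq> p" "(zx, zy) \<noteq> q"
      "near r (vx, vy) (zx, zy)" "zy \<le> qy"
    using third[of q "(vx, vy)"] v q by blast
  have not_pq: "\<not> near r p q" and not_pz: "\<not> near r p (zx, zy)" and not_qz: "\<not> near r q (zx, zy)"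
    using ind pS q z by blast+
  have zw: "vx \<le> zx + r" "zx \<le> vx + r" "vy \<le> zy + r"
    using z(4) by (auto simp: near_def)
  have pqw: "vx \<le> px + r" "px \<le> vx + r" "vx \<le> qx + r" "qx \<le> vx + r"
    using v by (auto simp: near_def pxy qxy)
  have gap: "qy + r < py"
  proof (rule ccontr)
    assume "\<not> qy + r < py"
    then have "py \<le> zy + r" "qy \<le> zy + r" "py \<le> qy + r"
      using zw(3) z(5) pb qb unfolding vy_def by auto
    then show False
      using not_pq not_pz not_qz z(5) pq zw pqw unfolding pxy qxy near_def by auto
  qed
  have vy: "vy = qy + r"
    using gap pb unfolding vy_def by simp
  have zy: "zy = qy"
    using zw(3) z(5) vy by simp
  have row: "\<exists>a b. (a, qy) \<in> S \<and> (b, qy) \<in> S \<and> a + r < b \<and> b \<le> a + 2 * r \<and>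
      px \<le> a + 2 * r \<and> b \<le> px + 2 * r"
  proof (cases "qx < zx")
    case True
    then show ?thesis
      using not_qz q z(1) pq zw pqw unfolding zy qxy near_def
      by (intro exI[of _ qx] exI[of _ zx]) auto
  next
    case False
    then show ?thesis
      using not_qz q z(1) pq zw pqw unfolding zy qxy near_def
      by (intro exI[of _ zx] exI[of _ qx]) auto
  qed
  then obtain a b where ab: "(a, qy) \<in> S" "(b, qy) \<in> S" "a + r < b" "b \<le> a + 2 * r"
      "px \<le> a + 2 * r" "b \<le> px + 2 * r"
    by blast
  have abb: "1 \<le> a" "b \<le> n"
    using bound[OF ab(1)] bound[OF ab(2)] by auto
  \<comment> \<open>A window at height \<open>qy + r\<close> around \<open>p\<close> and a member \<open>(w, qy)\<close> contains a further member,
      again in row \<open>qy\<close>.\<close>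
  have third_row: "\<exists>x. (x, qy) \<in> S \<and> x \<noteq> w \<and> x \<le> u + r \<and> u \<le> x + r"
    if "(w, qy) \<in> S" "1 \<le> u" "u \<le> n" "u \<le> px + r" "px \<le> u + r" "u \<le> w + r" "w \<le> u + r" for u w
  proof -
    have "(u, qy + r) \<in> {1..n} \<times> {1..n}" "near r (u, qy + r) p" "near r (u, qy + r) (w, qy)"
      "(w, qy) \<noteq> p"
      using that pb qb pq gap unfolding pxy near_def by auto
    with third[of "(w, qy)" "(u, qy + r)"] that(1)
    obtain x y where x: "(x, y) \<in> S" "(x, y) \<noteq> (w, qy)" "near r (u, qy + r) (x, y)" "y \<le> qy"
      by blast
    then have "y = qy"
      by (auto simp: near_def)
    with x show ?thesis
      by (auto simp: near_def)
  qed
  have row_gap: "x = x'" if "(x, qy) \<in> S" "(x', qy) \<in> S" "x \<le> x' + r" "x' \<le> x + r" for x x'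
    using ind[OF that(1,2)] that(3,4) by (auto simp: near_def)
  show False
  proof (cases "a < px")
    case True
    \<comment> \<open>Slide the window right until it just loses \<open>a\<close>; the next place right of \<open>b\<close> is out of reach.\<close>
    obtain x where x: "(x, qy) \<in> S" "x \<noteq> b" "x \<le> a + r + 1 + r" "a + r + 1 \<le> x + r"
      using third_row[of b "a + r + 1"] ab abb True by auto
    then have "\<not> (x \<le> b + r \<and> b \<le> x + r)" "\<not> (x \<le> a + r \<and> a \<le> x + r)"
      using row_gap[OF x(1) ab(2)] row_gap[OF x(1) ab(1)] by auto
    then show False
      using x(3,4) ab(3,4) by arith
  next
    case False
    \<comment> \<open>Now \<open>px \<le> a < b\<close>: slide left instead, to the center \<open>u = b - r - 1\<close>, which just loses \<open>b\<close>.\<close>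
    obtain u where u: "b = u + r + 1"
      using ab(3) less_imp_Suc_add[of "a + r" b] by (metis add.commute add.left_commute Suc_eq_plus1)
    obtain x where x: "(x, qy) \<in> S" "x \<noteq> a" "x \<le> u + r" "u \<le> x + r"
      using third_row[of a u] ab abb False u by auto
    then have "\<not> (x \<le> b + r \<and> b \<le> x + r)" "\<not> (x \<le> a + r \<and> a \<le> x + r)"
      using row_gap[OF x(1) ab(2)] row_gap[OF x(1) ab(1)] u by auto
    then show False
      using x(3,4) ab(3,4) u by arith
  qed
qed

lemma odd_independent_king_iff:
  "odd_independent_set (king_graph r n) S \<longleftrightarrow>
    S \<subseteq> {1..n} \<times> {1..n} \<and> (\<forall>p\<in>S. \<forall>q\<in>S. near (2 * r) p q \<longrightarrow> p = q)"
  (is "?L \<longleftrightarrow> ?R")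
proof
  assume ?L
  moreover from this have "S \<subseteq> {1..n} \<times> {1..n}"
    by (auto simp: odd_independent_set_def independent_set_def pverts_king)
  ultimately show ?R
    using odd_independent_imp_far by blast
next
  assume R: ?R
  have "p = q" if "p \<in> S" "q \<in> S" "near r p q" for p q
    using R that near_trans[OF near_refl that(3)] by blast
  then have "independent_set (king_graph r n) S"
    using R unfolding independent_set_def pverts_king parcs_king_iff by blast
  moreover have "odd (card (neighborhood (king_graph r n) v \<inter> S))"
    if v: "v \<in> {1..n} \<times> {1..n}" and ne: "neighborhood (king_graph r n) v \<inter> S \<noteq> {}" for v
  proof -
    obtain u where u: "u \<in> neighborhood (king_graph r n) v \<inter> S"
      using ne by blast
    have "near r v w" if "w \<in> neighborhood (king_graph r n) v" for w
      using that v by (simp add: neighborhood_king)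
    then have "w = u" if "w \<in> neighborhood (king_graph r n) v \<inter> S" for w
      using R u that near_trans[of r w v u] near_sym by blast
    with u have "neighborhood (king_graph r n) v \<inter> S = {u}"
      by blast
    then show ?thesis
      by simp
  qed
  ultimately show ?L
    unfolding odd_independent_set_def pverts_king by blast
qed

section \<open>The odd independence number\<close>

lemma le_add_if_div_eq:
  fixes m :: nat
  assumes "0 < m" "1 \<le> a" "1 \<le> b" "(a - 1) div m = (b - 1) div m"
  shows "a \<le> b + (m - 1)"
proof -
  have "a - 1 = m * ((b - 1) div m) + (a - 1) mod m" "(a - 1) mod m < m"
    "b - 1 = m * ((b - 1) div m) + (b - 1) mod m"
    using assms(1,4) mult_div_mod_eq[of m "a - 1"] by simp_all
  then show ?thesis
    using assms by linarith
qed

lemma nat_ceiling_divide: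
  fixes n m :: nat
  assumes "0 < m"
  shows "\<lceil>real n / real m\<rceil> = int ((n + m - 1) div m)"
proof (rule ceiling_unique)
  have "n \<le> m * ((n + m - 1) div m)"
    using assms mult_div_mod_eq[of m "n + m - 1"] mod_less_divisor[OF assms, of "n + m - 1"]
    by linarith
  then show "real n / real m \<le> of_int (int ((n + m - 1) div m))"
    using assms by (simp add: divide_le_eq mult.commute flip: of_nat_mult)
  have "m * ((n + m - 1) div m) \<le> n + m - 1"
    by simp
  then have "m * ((n + m - 1) div m) < n + m"
    using assms by linarith
  then have "real m * real ((n + m - 1) div m) < real n + real m"
    by (simp flip: of_nat_mult of_nat_add)
  then show "of_int (int ((n + m - 1) div m)) - 1 < real n / real m"
    using assms by (simp add: less_divide_eq algebra_simps)
qed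

lemma odd_independence_number_king:
  assumes "n \<ge> 1"
  shows "odd_independence_number (king_graph r n) = ((n + 2 * r) div (2 * r + 1)) ^ 2"
proof (rule antisym)
  define m where "m = 2 * r + 1"
  define k where "k = (n + 2 * r) div m"
  have m: "0 < m"
    by (simp add: m_def)
  have k_eq: "k = Suc ((n - 1) div m)"
  proof -
    have "n + 2 * r = (n - 1) + m"
      using assms by (simp add: m_def)
    then show ?thesis
      using m by (simp add: k_def)
  qed
  note att = odd_independence_number_attained[OF pair_graph_king_graph]
  obtain S where S: "odd_independent_set (king_graph r n) S"
      "card S = odd_independence_number (king_graph r n)"
    using att(1) by blast
  let ?cell = "\<lambda>(a, b). ((a - 1) div m, (b - 1) div m)"
  have sub: "S \<subseteq> {1..n} \<times> {1..n}" and far: "\<forall>p\<in>S. \<forall>q\<in>S. near (2 * r) p q \<longrightarrow> p = q"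
    using S(1) by (simp_all add: odd_independent_king_iff)
  have "inj_on ?cell S"
  proof (rule inj_onI)
    fix p q assume pq: "p \<in> S" "q \<in> S" "?cell p = ?cell q"
    have "p \<in> {1..n} \<times> {1..n}" "q \<in> {1..n} \<times> {1..n}"
      using pq sub by blast+
    then have "near (2 * r) p q"
      using pq(3) le_add_if_div_eq[OF m, of "fst p" "fst q"] le_add_if_div_eq[OF m, of "fst q" "fst p"]
        le_add_if_div_eq[OF m, of "snd p" "snd q"] le_add_if_div_eq[OF m, of "snd q" "snd p"]
      by (cases p; cases q) (auto simp: near_def m_def)
    then show "p = q"
      using far pq by blast
  qed
  moreover have "?cell ` S \<subseteq> {..<k} \<times> {..<k}"
    unfolding k_eq
    by (auto simp: less_Suc_eq_le intro!: div_le_mono diff_le_mono dest!: subsetD[OF sub])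
  then have "card (?cell ` S) \<le> k ^ 2"
    using card_mono[of "{..<k} \<times> {..<k}" "?cell ` S"] by (simp add: power2_eq_square)
  ultimately show "odd_independence_number (king_graph r n) \<le> ((n + 2 * r) div (2 * r + 1)) ^ 2"
    using S(2) by (simp add: card_image k_def m_def)

  let ?corner = "\<lambda>(i, j). (1 + i * m, 1 + j * m)"
  let ?C = "?corner ` ({..<k} \<times> {..<k})"
  have inj: "inj_on ?corner ({..<k} \<times> {..<k})"
    using m by (auto simp: inj_on_def)
  have in_grid: "1 + i * m \<le> n" if "i < k" for i
  proof -
    have "i * m \<le> (n - 1) div m * m"
      using that by (simp add: k_eq)
    also have "\<dots> \<le> n - 1"
      by simp
    finally show ?thesis
      using assms by simp
  qed
  have sep: "i = j" if "1 + i * m \<le> 1 + j * m + 2 * r" "1 + j * m \<le> 1 + i * m + 2 * r" for i j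
  proof (rule ccontr)
    assume "i \<noteq> j"
    then have "Suc i * m \<le> j * m \<or> Suc j * m \<le> i * m"
      by (metis mult_le_mono1 Suc_leI nat_neq_iff)
    then show False
      using that by (auto simp: m_def)
  qed
  have "odd_independent_set (king_graph r n) ?C"
    unfolding odd_independent_king_iff
  proof (intro conjI ballI impI)
    show "?C \<subseteq> {1..n} \<times> {1..n}"
      using in_grid by auto
    fix p q assume "p \<in> ?C" "q \<in> ?C" "near (2 * r) p q"
    then show "p = q"
      using sep by (auto simp: near_def)
  qed
  from att(2)[OF this] inj
  show "((n + 2 * r) div (2 * r + 1)) ^ 2 \<le> odd_independence_number (king_graph r n)"
    by (simp add: card_image k_def m_def power2_eq_square)
qed

section \<open>The strong odd chromatic number\<close>

lemma strong_odd_coloring_iff_classes: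
  assumes "pair_graph G"
  shows "strong_odd_coloring G c \<longleftrightarrow> (\<forall>k. odd_independent_set G {u \<in> pverts G. c u = k})"
proof -
  interpret pair_graph G by fact
  have color_class: "neighborhood G v \<inter> {u \<in> pverts G. c u = k} = {u \<in> neighborhood G v. c u = k}"
    for v k
    by (auto simp: neighborhood_def)
  have proper: "proper_coloring G c \<longleftrightarrow> (\<forall>k. independent_set G {u \<in> pverts G. c u = k})"
    unfolding proper_coloring_def independent_set_def
    using arc_fst_in_verts arc_snd_in_verts by fastforce
  \<comment> \<open>For a proper coloring, a vertex with a neighbor of color \<open>k\<close> lies outside the class of \<open>k\<close>.\<close>
  have "k \<in> c ` neighborhood G v \<longleftrightarrow>
      v \<notin> {u \<in> pverts G. c u = k} \<and> {u \<in> neighborhood G v. c u = k} \<noteq> {}"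
    if "proper_coloring G c" "v \<in> pverts G" for v k
    using that by (force simp: proper_coloring_def neighborhood_def)
  then show ?thesis
    unfolding strong_odd_coloring_def odd_independent_set_def color_class
    by (simp only: all_conj_distrib flip: proper) blast
qed

lemma strong_odd_coloring_king_iff:
  "strong_odd_coloring (king_graph r n) c \<longleftrightarrow>
    (\<forall>p \<in> {1..n} \<times> {1..n}. \<forall>q \<in> {1..n} \<times> {1..n}. near (2 * r) p q \<longrightarrow> c p = c q \<longrightarrow> p = q)"
  unfolding strong_odd_coloring_iff_classes[OF pair_graph_king_graph] odd_independent_king_iff
    pverts_king
  by blast

lemma mod_eq_imp_eq:
  fixes a b m :: nat
  assumes "a mod m = b mod m" "a < b + m" "b < a + m"
  shows "a = b"
proof -
  have "\<bar>int a - int b\<bar> < int m" "int m dvd int a - int b"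
    using assms by (auto simp flip: mod_eq_dvd_iff of_nat_mod)
  then show ?thesis
    using dvd_imp_le_int[of "int a - int b" "int m"] by fastforce
qed

lemma strong_odd_chromatic_number_king:
  "strong_odd_chromatic_number (king_graph r n) = (min n (2 * r + 1)) ^ 2"
proof (rule antisym)
  define m where "m = 2 * r + 1"
  let ?V = "{1..n} \<times> {1..n}"
  note att = strong_odd_chromatic_number_attained[OF pair_graph_king_graph[of r n],
      unfolded pverts_king]
  define c :: "nat \<times> nat \<Rightarrow> nat" where "c = (\<lambda>(a, b). m * (a mod m) + b mod m)"
  have m: "0 < m"
    by (simp add: m_def)
  have c_eq: "a mod m = a' mod m \<and> b mod m = b' mod m" if "c (a, b) = c (a', b')" for a b a' b'
  proof -
    have "c (a, b) div m = a mod m" "c (a, b) mod m = b mod m"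
      "c (a', b') div m = a' mod m" "c (a', b') mod m = b' mod m"
      using m by (simp_all add: c_def)
    then show ?thesis
      using that by metis
  qed
  have "strong_odd_coloring (king_graph r n) c"
    unfolding strong_odd_coloring_king_iff
  proof (intro ballI impI)
    fix p q :: "nat \<times> nat"
    assume "near (2 * r) p q" "c p = c q"
    then show "p = q"
      using c_eq[of "fst p" "snd p" "fst q" "snd q"] mod_eq_imp_eq[of "fst p" m "fst q"]
        mod_eq_imp_eq[of "snd p" m "snd q"]
      by (auto simp: near_def m_def prod_eq_iff)
  qed
  from att(2)[OF this] have le: "strong_odd_chromatic_number (king_graph r n) \<le> card (c ` ?V)" .
  have "card (c ` ?V) \<le> n ^ 2"
    using card_image_le[of ?V c] by (simp add: power2_eq_square)
  moreover have "c ` ?V \<subseteq> (\<lambda>(i, j). m * i + j) ` ({..<m} \<times> {..<m})"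
    using m by (auto simp: c_def image_iff intro!: bexI)
  then have "card (c ` ?V) \<le> m ^ 2"
    using surj_card_le[of "{..<m} \<times> {..<m}"] by (simp add: power2_eq_square)
  ultimately show "strong_odd_chromatic_number (king_graph r n) \<le> (min n (2 * r + 1)) ^ 2"
    using le unfolding m_def min_def by auto

  let ?s = "min n (2 * r + 1)"
  let ?B = "{1..?s} \<times> {1..?s}"
  obtain c' where c': "strong_odd_coloring (king_graph r n) c'"
      "card (c' ` ?V) = strong_odd_chromatic_number (king_graph r n)"
    using att(1) by blast
  have BV: "?B \<subseteq> ?V"
    by auto
  have "inj_on c' ?B"
  proof (rule inj_onI)
    fix p q assume pq: "p \<in> ?B" "q \<in> ?B" "c' p = c' q"
    then have "near (2 * r) p q"
      by (auto simp: near_def)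
    then show "p = q"
      using c'(1) pq BV unfolding strong_odd_coloring_king_iff by blast
  qed
  then have "?s ^ 2 = card (c' ` ?B)"
    by (simp add: card_image power2_eq_square)
  also have "\<dots> \<le> card (c' ` ?V)"
    using BV by (intro card_mono image_mono) auto
  finally show "?s ^ 2 \<le> strong_odd_chromatic_number (king_graph r n)"
    using c'(2) by simp
qed

theorem theorem17:
  fixes r n :: nat
  assumes "r \<ge> 1" and "n \<ge> 1"
  shows "int (odd_independence_number (king_graph r n)) = \<lceil>real n / real (2 * r + 1)\<rceil> ^ 2
    \<and> (n \<ge> 2 * r + 1 \<longrightarrow> strong_odd_chromatic_number (king_graph r n) = (2 * r + 1) ^ 2)
    \<and> (n \<le> 2 * r \<longrightarrow> strong_odd_chromatic_number (king_graph r n) = n ^ 2)"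
proof -
  have "\<lceil>real n / real (2 * r + 1)\<rceil> = int ((n + 2 * r) div (2 * r + 1))"
    using nat_ceiling_divide[of "2 * r + 1" n] by simp
  then show ?thesis
    using odd_independence_number_king[OF assms(2)]
    by (simp add: strong_odd_chromatic_number_king min_def)
qed

end
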